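(* Let $N\geq 2$ be an integer, let $\mathcal{A}$ be an associative unital $\mathbb{Z}_N$-graded algebra over $\mathbb{C}$ with unit element $e$, and let $q\in\mathbb{C}$ be a primitive $N$-th root of unity. If there exists an element $v\in\mathcal{A}$ of grading $1$ such that $v^N=\alpha e$ with $\alpha\in\mathbb{C}$, then $\mathcal{A}$, endowed with the homogeneous linear mapping $d_v:\mathcal{A}^k\to\mathcal{A}^{k+1}$ of degree $+1$ defined by $d_vw=[v,w]_q$, is a $\mathbb{Z}_N$-graded $q$-differential algebra, and $d_v$ is its $N$-differential.
   Context: $\mathbb{Z}_N=\mathbb{Z}/N\mathbb{Z}$. $\mathcal{A}^k\subset\mathcal{A}$ denotes the subspace of homogeneous elements of grading $k\in\mathbb{Z}_N$ (so $\mathcal{A}=\bigoplus_k\mathcal{A}^k$ and $\mathcal{A}^k\mathcal{A}^l\subset\mathcal{A}^{k+l}$), and $|w|=k$ means $w\in\mathcal{A}^k$. The $q$-commutator of homogeneous elements $w,w'$ is $[w,w']_q=ww'-q^{|w||w'|}w'w$ (well defined since $q^N=1$); thus $d_vw=vw-q^{|w|}wv$ for homogeneous $w$, extended linearly to $\mathcal{A}$. For $q$ a primitive $N$-th root of unity ($q\neq1$), a ($\mathbb{Z}_N$-)graded $q$-differential algebra is a unital associative $\mathbb{Z}_N$-graded algebra endowed with a linear mapping $d$ of degree $+1$ (i.e. $d(\mathcal{A}^k)\subset\mathcal{A}^{k+1}$) satisfying the graded $q$-Leibniz rule $d(ww')=d(w)w'+q^{|w|}w\,d(w')$ for all homogeneous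 $w,w'$, and $d^N=0$. The mapping $d$ is then called the $N$-differential of the graded $q$-differential algebra. *)

theory Defs
  imports Complex_Main
begin

text \<open>
  The sort \<open>{ring, monoid_mult}\<close> instead of \<open>ring_1\<close> keeps the zero algebra, where \<open>1 = 0\<close>.
\<close>

locale complex_algebra = vector_space scale
  for scale :: "complex \<Rightarrow> 'a::{ring, monoid_mult} \<Rightarrow> 'a" (infixr \<open>*s\<close> 75) +
  assumes scale_mult_left: "(c *s x) * y = c *s (x * y)"
    and scale_mult_right: "x * (c *s y) = c *s (x * y)"

text \<open>
  Elements of the grading group of integers modulo \<open>N\<close> are represented by their residues
  \<open>k < N\<close>; \<open>A k\<close> is meaningless for \<open>k \<ge> N\<close>, and degrees are added modulo \<open>N\<close>.
\<close>

definition is_decomposition :: "nat \<Rightarrow> (nat \<Rightarrow> 'a::comm_monoid_add set) \<Rightarrow> 'a \<Rightarrow> (nat \<Rightarrow> 'a) \<Rightarrow> bool"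
  where "is_decomposition N A w c \<longleftrightarrow>
    (\<forall>k<N. c k \<in> A k) \<and> (\<forall>k\<ge>N. c k = 0) \<and> w = (\<Sum>k<N. c k)"

locale graded_algebra = complex_algebra scale
  for scale :: "complex \<Rightarrow> 'a::{ring, monoid_mult} \<Rightarrow> 'a" (infixr \<open>*s\<close> 75) +
  fixes N :: nat and A :: "nat \<Rightarrow> 'a set"
  assumes N_pos: "0 < N"
    and subspace_A: "k < N \<Longrightarrow> subspace (A k)"
    and direct_sum: "\<exists>!c. is_decomposition N A w c"
    and mult_A: "\<lbrakk>k < N; l < N; x \<in> A k; y \<in> A l\<rbrakk> \<Longrightarrow> x * y \<in> A ((k + l) mod N)"

definition component :: "nat \<Rightarrow> (nat \<Rightarrow> 'a::comm_monoid_add set) \<Rightarrow> 'a \<Rightarrow> nat \<Rightarrow> 'a"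
  where "component N A w = (THE c. is_decomposition N A w c)"

text \<open>
  Only for \<open>0\<close> does the choice of a degree matter, and there the \<open>q\<close>-commutator below vanishes
  whatever degree is chosen.  The value at an inhomogeneous element is unspecified.
\<close>

definition gdeg :: "nat \<Rightarrow> (nat \<Rightarrow> 'a set) \<Rightarrow> 'a \<Rightarrow> nat"
  where "gdeg N A w = (SOME k. k < N \<and> w \<in> A k)"

definition q_commutator ::
  "(complex \<Rightarrow> 'a::{ring, monoid_mult} \<Rightarrow> 'a) \<Rightarrow> nat \<Rightarrow> (nat \<Rightarrow> 'a set) \<Rightarrow> complex \<Rightarrow> 'a \<Rightarrow> 'a \<Rightarrow> 'a"
  where "q_commutator scale N A q w w' =
    w * w' - scale (q ^ (gdeg N A w * gdeg N A w')) (w' * w)"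

definition d_inner ::
  "(complex \<Rightarrow> 'a::{ring, monoid_mult} \<Rightarrow> 'a) \<Rightarrow> nat \<Rightarrow> (nat \<Rightarrow> 'a set) \<Rightarrow> complex \<Rightarrow> 'a \<Rightarrow> 'a \<Rightarrow> 'a"
  where "d_inner scale N A q v w = (\<Sum>k<N. q_commutator scale N A q v (component N A w k))"

definition primitive_root_of_unity :: "nat \<Rightarrow> complex \<Rightarrow> bool"
  where "primitive_root_of_unity N q \<longleftrightarrow> 0 < N \<and> q ^ N = 1 \<and> (\<forall>k. 0 < k \<and> k < N \<longrightarrow> q ^ k \<noteq> 1)"

locale graded_q_differential_algebra = graded_algebra scale N A
  for scale :: "complex \<Rightarrow> 'a::{ring, monoid_mult} \<Rightarrow> 'a" (infixr \<open>*s\<close> 75)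
    and N :: nat and A :: "nat \<Rightarrow> 'a set" +
  fixes q :: complex and d :: "'a \<Rightarrow> 'a"
  assumes primitive_q: "primitive_root_of_unity N q"
    and q_neq_1: "q \<noteq> 1"
    and linear_d: "Vector_Spaces.linear scale scale d"
    and degree_d: "\<lbrakk>k < N; w \<in> A k\<rbrakk> \<Longrightarrow> d w \<in> A ((k + 1) mod N)"
    and q_Leibniz: "\<lbrakk>k < N; l < N; w \<in> A k; w' \<in> A l\<rbrakk> \<Longrightarrow>
      d (w * w') = d w * w' + q ^ k *s (w * d w')"
    and d_nilpotent: "(d ^^ N) w = 0"

context graded_algebra
begin

lemma zero_in_A: "k < N \<Longrightarrow> 0 \<in> A k"
  using subspace_A subspace_0 by blast

lemma is_decomposition_homogeneous:
  assumes "k < N" "w \<in> A k"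
  shows "is_decomposition N A w (\<lambda>i. if i = k then w else 0)"
  using assms by (auto simp: is_decomposition_def zero_in_A)

lemma component_eqI: "is_decomposition N A w c \<Longrightarrow> component N A w = c"
  unfolding component_def using direct_sum by (rule the1_equality)

lemma component_homogeneous:
  assumes "k < N" "w \<in> A k"
  shows "component N A w = (\<lambda>i. if i = k then w else 0)"
  by (rule component_eqI[OF is_decomposition_homogeneous[OF assms]])

lemma gdeg_eq:
  assumes "k < N" "w \<in> A k" "w \<noteq> 0"
  shows "gdeg N A w = k"
proof -
  have "gdeg N A w < N \<and> w \<in> A (gdeg N A w)"
    unfolding gdeg_def by (rule someI[of _ k]) (use assms in simp)
  then have "(\<lambda>i. if i = gdeg N A w then w else 0) = (\<lambda>i. if i = k then w else 0)"
    using component_homogeneous assms(1,2) by metis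
  then show ?thesis
    using assms(3) by (metis (full_types))
qed

lemma q_commutator_homogeneous:
  assumes "k < N" "l < N" "w \<in> A k" "w' \<in> A l"
  shows "q_commutator scale N A q w w' = w * w' - q ^ (k * l) *s (w' * w)"
  using assms by (cases "w = 0 \<or> w' = 0") (auto simp: q_commutator_def gdeg_eq)

lemma d_inner_homogeneous:
  assumes "k < N" "w \<in> A k"
  shows "d_inner scale N A q v w = q_commutator scale N A q v w"
proof -
  have "q_commutator scale N A q v (if i = k then w else 0) =
      (if i = k then q_commutator scale N A q v w else 0)" for i
    by (simp add: q_commutator_def)
  then show ?thesis
    using assms by (simp add: d_inner_def component_homogeneous)
qed

end

end

theory Submission
  imports Defs "HOL-Computational_Algebra.Polynomial"
begin

text \<open>
  On homogeneous elements of degree \<open>k\<close> the map \<open>d\<close> is \<open>L - q\<^sup>k R\<close>, where \<open>L\<close> and \<open>R\<close> are left and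
  right multiplication by \<open>v\<close>.  The degree and the \<open>q\<close>-Leibniz rule are read off from this formula,
  the latter because \<open>q\<^sup>N = 1\<close> makes \<open>q\<^sup>k q\<^sup>l\<close> depend only on \<open>k + l\<close> modulo \<open>N\<close>.

  The point is \<open>d\<^sup>N = 0\<close>.  Each application of \<open>d\<close> raises the degree by one, so on degree \<open>k\<close>
  the iterate \<open>d\<^sup>N\<close> is the product of the operators \<open>L - q\<^bsup>k+j\<^esup> R\<close> for \<open>j < N\<close>.  Since \<open>L\<close> and \<open>R\<close>
  commute, this product is the homogenization, evaluated at \<open>L\<close> and \<open>R\<close>, of the polynomial
  with linear factors \<open>X - q\<^bsup>k+j\<^esup>\<close>.  The numbers \<open>q\<^bsup>k+j\<^esup>\<close> run through all \<open>N\<close>-th roots of unity, so this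
  polynomial is \<open>X\<^sup>N - 1\<close> (lemma \<open>prod_linear_factors_root_of_unity\<close>), and \<open>d\<^sup>N w = v\<^sup>N w - w v\<^sup>N\<close>
  (lemmas \<open>d_inner_power\<close> and \<open>two_sided_action_monom_minus_one\<close>).  This vanishes because
  \<open>v\<^sup>N\<close> is a multiple of the unit and hence central.  Compared with the usual expansion, the
  factorization replaces the Gaussian binomial coefficients and their vanishing at roots of unity.
\<close>

section \<open>Roots of unity\<close>

lemma power_mod_exponent:
  fixes q :: "'a::monoid_mult"
  assumes "q ^ N = 1"
  shows "q ^ (m mod N) = q ^ m"
proof -
  have "q ^ m = q ^ (N * (m div N) + m mod N)" by simp
  also have "\<dots> = q ^ (m mod N)"
    using assms by (simp only: power_add power_mult) simp
  finally show ?thesis by simp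
qed

lemma inj_on_powers_root_of_unity:
  assumes "primitive_root_of_unity N q"
  shows "inj_on (\<lambda>j. q ^ (k + j)) {..<N}"
proof -
  have q: "q ^ N = 1" "0 < N" "\<And>m. 0 < m \<Longrightarrow> m < N \<Longrightarrow> q ^ m \<noteq> 1"
    using assms by (auto simp: primitive_root_of_unity_def)
  then have "q \<noteq> 0" by (metis power_eq_0_iff zero_neq_one zero_power)
  have "q ^ (k + i) \<noteq> q ^ (k + j)" if "i < j" "j < N" for i j
  proof
    assume "q ^ (k + i) = q ^ (k + j)"
    also have "q ^ (k + j) = q ^ (k + i) * q ^ (j - i)"
      using that by (simp flip: power_add)
    finally have "q ^ (j - i) = 1" using \<open>q \<noteq> 0\<close> by simp
    then show False using q(3)[of "j - i"] that by simp
  qed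
  then show ?thesis
    by (intro linorder_inj_onI') (auto)
qed

text \<open>
  A shift of the exponent by \<open>k\<close> only permutes the \<open>N\<close>-th roots of unity, so the product does not
  depend on the degree \<open>k\<close> at which the iteration of the differential starts.
\<close>

lemma prod_linear_factors_root_of_unity:
  assumes "primitive_root_of_unity N q"
  shows "(\<Prod>j<N. [:- (q ^ (k + j)), 1:]) = monom 1 N - 1"
proof (rule poly_eqI_degree_lead_coeff)
  let ?P = "\<Prod>j<N. [:- (q ^ (k + j)), 1:]"
  let ?R = "(\<lambda>j. q ^ (k + j)) ` {..<N}"
  have N: "0 < N" "q ^ N = 1" using assms by (auto simp: primitive_root_of_unity_def)
  have deg: "degree ?P = N"
    by (subst degree_prod_eq_sum_degree) auto
  then show "degree ?P \<le> N" by simp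
  show "degree (monom 1 N - 1 :: complex poly) \<le> N"
    by (intro degree_diff_le) (auto simp: degree_monom_le)
  show "coeff ?P N = coeff (monom 1 N - 1) N"
    using lead_coeff_prod[of "\<lambda>j. [:- (q ^ (k + j)), 1:]" "{..<N}"] deg N by simp
  show "N \<le> card ?R"
    using inj_on_powers_root_of_unity[OF assms] by (simp add: card_image)
  show "poly ?P x = poly (monom 1 N - 1) x" if x: "x \<in> ?R" for x
  proof -
    from x obtain j where j: "j < N" "x = q ^ (k + j)" by auto
    have "x ^ N = 1"
      unfolding j(2) by (metis N(2) mult.commute power_mult power_one)
    moreover have "poly ?P x = 0"
      using j by (auto simp: poly_prod)
    ultimately show ?thesis by (simp add: poly_monom)
  qed
qed

section \<open>Homogeneous polynomials in left and right multiplication\<close>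

text \<open>
  The homogenization of degree \<open>n\<close> of \<open>p\<close>, evaluated at the commuting operators of left and right
  multiplication by \<open>v\<close>.  It is meant for \<open>degree p \<le> n\<close>: higher coefficients are cut off.
\<close>

definition two_sided_action ::
  "(complex \<Rightarrow> 'a::{ring, monoid_mult} \<Rightarrow> 'a) \<Rightarrow> 'a \<Rightarrow> nat \<Rightarrow> complex poly \<Rightarrow> 'a \<Rightarrow> 'a"
  where "two_sided_action scale v n p w =
    (\<Sum>i\<le>n. scale (coeff p i) (v ^ i * w * v ^ (n - i)))"

context complex_algebra
begin

text \<open>
  Homogenization is multiplicative, and \<open>X - c\<close> homogenizes to left multiplication minus \<open>c\<close>
  times right multiplication; this is the recursion that the iterates of the inner differential obey.
\<close>

lemma two_sided_action_linear_factor: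
  assumes "degree p \<le> n"
  shows "two_sided_action scale v (Suc n) ([:- c, 1:] * p) w =
    v * two_sided_action scale v n p w - c *s (two_sided_action scale v n p w * v)"
proof -
  let ?m = "\<lambda>i. v ^ i * w * v ^ (Suc n - i)"
  have coeff: "coeff ([:- c, 1:] * p) i = (case i of 0 \<Rightarrow> 0 | Suc j \<Rightarrow> coeff p j) - c * coeff p i" for i
    by (simp add: coeff_pCons split: nat.split)
  have "two_sided_action scale v (Suc n) ([:- c, 1:] * p) w =
      (\<Sum>i\<le>Suc n. (case i of 0 \<Rightarrow> 0 | Suc j \<Rightarrow> coeff p j) *s ?m i) - (\<Sum>i\<le>Suc n. (c * coeff p i) *s ?m i)"
    unfolding two_sided_action_def coeff by (simp only: scale_left_diff_distrib sum_subtractf)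
  also have "(\<Sum>i\<le>Suc n. (case i of 0 \<Rightarrow> 0 | Suc j \<Rightarrow> coeff p j) *s ?m i) =
      v * two_sided_action scale v n p w"
    by (simp add: two_sided_action_def sum.atMost_Suc_shift sum_distrib_left scale_mult_right mult.assoc
        del: sum.atMost_Suc)
  also have "(\<Sum>i\<le>Suc n. (c * coeff p i) *s ?m i) = (\<Sum>i\<le>n. (c * coeff p i) *s ?m i)"
    using assms by (simp add: coeff_eq_0)
  also have "\<dots> = c *s (two_sided_action scale v n p w * v)"
    unfolding two_sided_action_def sum_distrib_right scale_sum_right
    by (intro sum.cong refl) (simp add: scale_mult_left Suc_diff_le mult.assoc power_commutes)
  finally show ?thesis .
qed

lemma two_sided_action_monom_minus_one:
  assumes "0 < n"
  shows "two_sided_action scale v n (monom 1 n - 1) w = v ^ n * w - w * v ^ n"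
proof -
  have "two_sided_action scale v n (monom 1 n - 1) w =
      (\<Sum>i\<le>n. (if i = n then v ^ i * w * v ^ (n - i) else 0))
      - (\<Sum>i\<le>n. (if i = 0 then v ^ i * w * v ^ (n - i) else 0))"
    unfolding two_sided_action_def sum_subtractf[symmetric]
    by (intro sum.cong refl) (simp add: scale_left_diff_distrib)
  then show ?thesis by simp
qed

end

section \<open>The inner differential\<close>

context graded_algebra
begin

lemma decomposition: "is_decomposition N A w (component N A w)"
  using direct_sum component_eqI by metis

lemma component_in: "k < N \<Longrightarrow> component N A w k \<in> A k"
  using decomposition by (simp add: is_decomposition_def)

lemma sum_components: "(\<Sum>k<N. component N A w k) = w"
  using decomposition by (simp add: is_decomposition_def)

lemma component_add: "component N A (w + w') k = component N A w k + component N A w' k"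
proof -
  have "is_decomposition N A (w + w') (\<lambda>k. component N A w k + component N A w' k)"
    using decomposition[of w] decomposition[of w'] subspace_A
    by (auto simp: is_decomposition_def sum.distrib intro: subspace_add)
  from component_eqI[OF this] show ?thesis by simp
qed

lemma component_scale: "component N A (c *s w) k = c *s component N A w k"
proof -
  have "is_decomposition N A (c *s w) (\<lambda>k. c *s component N A w k)"
    using decomposition[of w] subspace_A
    by (auto simp: is_decomposition_def intro: subspace_scale simp flip: scale_sum_right)
  from component_eqI[OF this] show ?thesis by simp
qed

context
  fixes v :: 'a and q :: complex
  assumes N_ge_2: "2 \<le> N" and v_degree: "v \<in> A 1"
begin

abbreviation "d \<equiv> d_inner scale N A q v"

lemma d_eq_on_degree:
  assumes "k < N" "w \<in> A k"
  shows "d w = v * w - q ^ k *s (w * v)"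
  using q_commutator_homogeneous[of 1 k v w q] d_inner_homogeneous[of k w q v] assms N_ge_2 v_degree
  by simp

lemma d_eq_sum:
  "d w = (\<Sum>k<N. v * component N A w k - q ^ k *s (component N A w k * v))"
  unfolding d_inner_def
  by (intro sum.cong refl)
     (use q_commutator_homogeneous[of 1 _ v _ q] component_in N_ge_2 v_degree in simp)

lemma linear_d_inner: "Vector_Spaces.linear scale scale d"
proof
  show "d (x + y) = d x + d y" for x y
    by (simp add: d_eq_sum component_add ring_distribs scale_right_distrib
        flip: sum.distrib) (simp add: algebra_simps)
  show "d (c *s x) = c *s d x" for c x
    by (simp add: d_eq_sum component_scale scale_sum_right scale_right_diff_distrib
        scale_mult_left scale_mult_right mult.commute)
qed

lemma d_inner_degree:
  assumes "k < N" "w \<in> A k"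
  shows "d w \<in> A ((k + 1) mod N)"
proof -
  have "v * w \<in> A ((k + 1) mod N)" "w * v \<in> A ((k + 1) mod N)"
    using mult_A[of 1 k v w] mult_A[of k 1 w v] assms N_ge_2 v_degree by auto
  moreover have "subspace (A ((k + 1) mod N))"
    using subspace_A N_pos by simp
  ultimately show ?thesis
    unfolding d_eq_on_degree[OF assms] by (intro subspace_diff subspace_scale)
qed

lemma d_inner_Leibniz:
  assumes q: "q ^ N = 1"
    and "k < N" "l < N" "w \<in> A k" "w' \<in> A l"
  shows "d (w * w') = d w * w' + q ^ k *s (w * d w')"
proof -
  have "w * w' \<in> A ((k + l) mod N)" "(k + l) mod N < N"
    using mult_A assms N_pos by auto
  then have "d (w * w') = v * (w * w') - q ^ (k + l) *s (w * w' * v)"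
    using d_eq_on_degree power_mod_exponent[OF q] by simp
  then show ?thesis
    using assms
    by (simp add: d_eq_on_degree ring_distribs scale_right_diff_distrib
        scale_mult_left scale_mult_right power_add mult.assoc algebra_simps)
qed

lemma d_inner_power_degree:
  assumes "k < N" "w \<in> A k"
  shows "(d ^^ n) w \<in> A ((k + n) mod N)"
proof (induction n)
  case (Suc n)
  then have "d ((d ^^ n) w) \<in> A (((k + n) mod N + 1) mod N)"
    using d_inner_degree N_pos by simp
  then show ?case by (simp add: mod_simps)
qed (use assms in simp)

text \<open>
  The factors depend on \<open>j\<close> because the \<open>j\<close>-th application of \<open>d\<close> acts on an element of degree
  \<open>k + j\<close>; since \<open>q\<^sup>N = 1\<close>, the exponent need not be reduced modulo \<open>N\<close>.
\<close>

lemma d_inner_power: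
  assumes q: "q ^ N = 1" and w: "k < N" "w \<in> A k"
  shows "(d ^^ n) w = two_sided_action scale v n (\<Prod>j<n. [:- (q ^ (k + j)), 1:]) w"
proof (induction n)
  case 0
  show ?case by (simp add: two_sided_action_def)
next
  case (Suc n)
  let ?p = "\<Prod>j<n. [:- (q ^ (k + j)), 1:]"
  have "degree ?p \<le> n"
    by (subst degree_prod_eq_sum_degree) auto
  moreover have "d ((d ^^ n) w) = v * (d ^^ n) w - q ^ (k + n) *s ((d ^^ n) w * v)"
    using d_eq_on_degree[OF _ d_inner_power_degree[OF w]] N_pos power_mod_exponent[OF q] by simp
  ultimately show ?case
    using two_sided_action_linear_factor[of ?p n v "q ^ (k + n)" w] Suc
    by (simp add: mult.commute)
qed

lemma d_inner_nilpotent: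
  assumes q: "primitive_root_of_unity N q" and v_power: "v ^ N = \<alpha> *s 1"
  shows "(d ^^ N) w = 0"
proof -
  have lin: "Vector_Spaces.linear scale scale (d ^^ n)" for n
  proof (induction n)
    case 0
    show ?case by (simp add: linear_id[unfolded id_def] id_def)
  next
    case (Suc n)
    then show ?case
      using Vector_Spaces.linear_compose[OF Suc linear_d_inner] by (simp add: o_def)
  qed
  have homogeneous: "(d ^^ N) x = 0" if "k < N" "x \<in> A k" for k x
  proof -
    have "(d ^^ N) x = v ^ N * x - x * v ^ N"
      using d_inner_power[OF _ that] q[unfolded primitive_root_of_unity_def] prod_linear_factors_root_of_unity[OF q]
        two_sided_action_monom_minus_one[OF N_pos] by simp
    then show ?thesis
      by (simp add: v_power scale_mult_left scale_mult_right)
  qed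
  have "(d ^^ N) w = (\<Sum>k<N. (d ^^ N) (component N A w k))"
    using module_hom.sum[OF lin[unfolded linear_iff_module_hom]] sum_components by metis
  then show ?thesis
    using homogeneous component_in by simp
qed

end

end

theorem mainTheorem3:
  fixes scale :: "complex \<Rightarrow> 'a::{ring, monoid_mult} \<Rightarrow> 'a"
    and N :: nat and A :: "nat \<Rightarrow> 'a set" and q \<alpha> :: complex and v :: 'a
  assumes "2 \<le> N"
    and "graded_algebra scale N A"
    and "primitive_root_of_unity N q"
    and "v \<in> A 1"
    and "v ^ N = scale \<alpha> 1"
  shows "graded_q_differential_algebra scale N A q (d_inner scale N A q v)"
proof -
  interpret graded_algebra scale N A by fact
  have "q ^ N = 1"
    using assms(3) by (simp add: primitive_root_of_unity_def)
  have "q ^ 1 \<noteq> 1"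
    using assms(1,3) unfolding primitive_root_of_unity_def by (metis Suc_1 Suc_le_lessD less_one One_nat_def)
  then show ?thesis
    using assms linear_d_inner d_inner_degree d_inner_Leibniz[OF _ _ \<open>q ^ N = 1\<close>] d_inner_nilpotent
    by (intro graded_q_differential_algebra.intro graded_q_differential_algebra_axioms.intro) auto
qed

end
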